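(* Let $G=(S,T;E)$ with $S=\{s_1,\dots,s_n\}$, $w:E\to\mathbb R_+$ and $d\in\mathbb Z_+$. Then the optimum value of the linear program (LP1) is at most $\left(2-\frac{1}{2d-1}\right)$ times the maximum weight of a $d$-distance matching of $G$; that is, the integrality gap of (LP1) is at most $2-\frac{1}{2d-1}$.
   Context: $G$ is a finite bipartite graph without loops or parallel edges; the nodes of $S$ are in the fixed order $s_1,\dots,s_n$. A $d$-distance matching is a subset $M\subseteq E$ such that every node of $S$ is incident to at most one edge of $M$, and whenever $s_it,s_jt\in M$ with $i\ne j$, $t\in T$, we have $|j-i|\ge d$; its weight is $\sum_{e\in M}w(e)$. $\Delta(v)$ is the set of edges incident to $v$, and $R_d(s_i)=\{s_i,\dots,s_{\min(i+d-1,n)}\}$. (LP1) is: maximize $\sum_{st\in E}w_{st}x_{st}$ subject to $x\in\mathbb R_+^E$, $\sum_{st\in\Delta(s)}x_{st}\le 1$ for all $s\in S$, and $\sum_{s't\in E:\,s'\in R_d(s)}x_{s't}\le1$ for all $s\in S,t\in T$. *)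

theory Defs
  imports "HOL-Analysis.Analysis"
begin

text \<open>
  A bipartite graph is given by its colour classes \<open>S\<close>, \<open>T\<close> and an edge set
  \<open>E \<subseteq> S \<times> T\<close>; an edge \<open>st\<close> is the pair \<open>(s, t)\<close>, so there are neither loops nor parallel
  edges, and the two classes are disjoint because they live in different types. The fixed order of
  \<open>S\<close> is an enumeration \<open>s\<close>, a bijection from \<open>{1..n}\<close> onto \<open>S\<close>.
\<close>

definition incident :: "('a \<times> 'b) set \<Rightarrow> 'a \<Rightarrow> ('a \<times> 'b) set" where
  "incident E v = {e \<in> E. fst e = v}"

text \<open>The set $R_d(s_i)$, for \<open>i \<ge> 1\<close>; it is empty if \<open>d = 0\<close>.\<close>

definition window :: "(nat \<Rightarrow> 'a) \<Rightarrow> nat \<Rightarrow> nat \<Rightarrow> nat \<Rightarrow> 'a set" where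
  "window s n d i = s ` {i..min (i + d - 1) n}"

definition distance_matching ::
    "(nat \<Rightarrow> 'a) \<Rightarrow> nat \<Rightarrow> 'b set \<Rightarrow> ('a \<times> 'b) set \<Rightarrow> nat \<Rightarrow> ('a \<times> 'b) set \<Rightarrow> bool" where
  "distance_matching s n T E d M \<longleftrightarrow>
     M \<subseteq> E \<and>
     (\<forall>i\<in>{1..n}. card (incident M (s i)) \<le> 1) \<and>
     (\<forall>i\<in>{1..n}. \<forall>j\<in>{1..n}. \<forall>t\<in>T.
        i \<noteq> j \<longrightarrow> (s i, t) \<in> M \<longrightarrow> (s j, t) \<in> M \<longrightarrow> int d \<le> \<bar>int j - int i\<bar>)"

definition max_weight ::
    "(nat \<Rightarrow> 'a) \<Rightarrow> nat \<Rightarrow> 'b set \<Rightarrow> ('a \<times> 'b) set \<Rightarrow> nat \<Rightarrow> ('a \<times> 'b \<Rightarrow> real) \<Rightarrow> real" where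
  "max_weight s n T E d w = Max {\<Sum>e\<in>M. w e | M. distance_matching s n T E d M}"

text \<open>
  Vectors indexed by \<open>E\<close> are functions on all pairs; only their values on \<open>E\<close> matter.
\<close>

definition lp1_feasible ::
    "(nat \<Rightarrow> 'a) \<Rightarrow> nat \<Rightarrow> 'b set \<Rightarrow> ('a \<times> 'b) set \<Rightarrow> nat \<Rightarrow> ('a \<times> 'b \<Rightarrow> real) \<Rightarrow> bool" where
  "lp1_feasible s n T E d x \<longleftrightarrow>
     (\<forall>e\<in>E. 0 \<le> x e) \<and>
     (\<forall>i\<in>{1..n}. (\<Sum>e\<in>incident E (s i). x e) \<le> 1) \<and>
     (\<forall>i\<in>{1..n}. \<forall>t\<in>T. (\<Sum>v | v \<in> window s n d i \<and> (v, t) \<in> E. x (v, t)) \<le> 1)"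

definition lp1_value :: "('a \<times> 'b) set \<Rightarrow> ('a \<times> 'b \<Rightarrow> real) \<Rightarrow> ('a \<times> 'b \<Rightarrow> real) \<Rightarrow> real" where
  "lp1_value E w x = (\<Sum>e\<in>E. w e * x e)"

definition lp1_opt ::
    "(nat \<Rightarrow> 'a) \<Rightarrow> nat \<Rightarrow> 'b set \<Rightarrow> ('a \<times> 'b) set \<Rightarrow> nat \<Rightarrow> ('a \<times> 'b \<Rightarrow> real) \<Rightarrow> real" where
  "lp1_opt s n T E d w = Sup (lp1_value E w ` {x. lp1_feasible s n T E d x})"

definition lp1_int_opt ::
    "(nat \<Rightarrow> 'a) \<Rightarrow> nat \<Rightarrow> 'b set \<Rightarrow> ('a \<times> 'b) set \<Rightarrow> nat \<Rightarrow> ('a \<times> 'b \<Rightarrow> real) \<Rightarrow> real" where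
  "lp1_int_opt s n T E d w =
     Sup (lp1_value E w ` {x. lp1_feasible s n T E d x \<and> (\<forall>e\<in>E. x e \<in> \<int>)})"

text \<open>
  The ratio is taken in the extended reals, where \<open>0 / 0 = 0\<close> but \<open>c / 0 = \<infinity>\<close> for \<open>c > 0\<close>, so that a
  bound on it also says that the fractional optimum vanishes whenever the integral one does.
\<close>

definition lp1_integrality_gap ::
    "(nat \<Rightarrow> 'a) \<Rightarrow> nat \<Rightarrow> 'b set \<Rightarrow> ('a \<times> 'b) set \<Rightarrow> nat \<Rightarrow> ('a \<times> 'b \<Rightarrow> real) \<Rightarrow> ereal" where
  "lp1_integrality_gap s n T E d w =
     ereal (lp1_opt s n T E d w) / ereal (lp1_int_opt s n T E d w)"

text \<open>The suprema and the maximum above are well-behaved: all of them are attained.\<close>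

lemma lp1_feasible_le_1:
  assumes bij: "bij_betw s {1..n} S" and fin: "finite E" and E: "E \<subseteq> S \<times> T"
    and x: "lp1_feasible s n T E d x" and e: "e \<in> E"
  shows "x e \<le> 1"
proof -
  obtain i where i: "i \<in> {1..n}" "fst e = s i"
    using bij E e unfolding bij_betw_def by force
  have "x e \<le> (\<Sum>e\<in>incident E (s i). x e)"
    using fin x e i by (intro member_le_sum) (auto simp: incident_def lp1_feasible_def)
  also have "\<dots> \<le> 1" using x i by (auto simp: lp1_feasible_def)
  finally show ?thesis .
qed

lemma lp1_attained_aux:
  fixes E :: "('a \<times> 'b) set" and d :: nat and w :: "'a \<times> 'b \<Rightarrow> real"
  assumes bij: "bij_betw s {1..n} S" and fin: "finite E" and E: "E \<subseteq> S \<times> T"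
    and C: "closed C" "0 \<in> C"
  defines "F \<equiv> {x. lp1_feasible s n T E d x \<and> (\<forall>e\<in>E. x e \<in> C)}"
  shows "\<exists>x\<in>F. lp1_value E w x = Sup (lp1_value E w ` F) \<and> (\<forall>y\<in>F. lp1_value E w y \<le> lp1_value E w x)"
proof -
  define K where "K = PiE UNIV (\<lambda>e. if e \<in> E then {0..1::real} else {0})"
  have "compactin (product_topology (\<lambda>_. euclidean) UNIV) K"
    unfolding K_def by (subst compactin_PiE) auto
  hence K: "compact K"
    by (simp add: euclidean_product_topology compactin_euclidean_iff)
  have cont: "continuous_on UNIV (\<lambda>x::'a \<times> 'b \<Rightarrow> real. x e)" for e
    by (intro continuous_on_product_coordinates)
  have "closed F"
    unfolding F_def lp1_feasible_def Ball_def
    by (intro closed_Collect_conj closed_Collect_all closed_Collect_imp closed_Collect_le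
        open_Collect_const continuous_on_sum cont continuous_on_const
        closed_vimage[OF C(1), unfolded vimage_def])
  hence FK: "compact (K \<inter> F)" using K by (simp add: compact_Int_closed)
  have "(\<lambda>_. 0) \<in> K \<inter> F"
    using C by (auto simp: K_def F_def lp1_feasible_def)
  moreover have "continuous_on (K \<inter> F) (lp1_value E w)"
    unfolding lp1_value_def
    by (intro continuous_on_sum continuous_on_mult continuous_on_const continuous_on_subset[OF cont]) auto
  ultimately obtain x where x: "x \<in> K \<inter> F" "\<And>y. y \<in> K \<inter> F \<Longrightarrow> lp1_value E w y \<le> lp1_value E w x"
    using continuous_attains_sup[OF FK, of "lp1_value E w"] by auto
  have max: "lp1_value E w y \<le> lp1_value E w x" if y: "y \<in> F" for y
  proof -
    define z where "z = (\<lambda>e. if e \<in> E then y e else 0)"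
    have eq: "\<And>e. e \<in> E \<Longrightarrow> z e = y e" by (simp add: z_def)
    have "lp1_feasible s n T E d z \<longleftrightarrow> lp1_feasible s n T E d y"
      unfolding lp1_feasible_def incident_def using eq by (simp cong: conj_cong)
    hence "z \<in> K \<inter> F"
      using y lp1_feasible_le_1[OF bij fin E]
      by (auto simp: K_def F_def z_def lp1_feasible_def)
    moreover have "lp1_value E w z = lp1_value E w y"
      by (simp add: lp1_value_def z_def)
    ultimately show ?thesis using x(2) by metis
  qed
  have "Sup (lp1_value E w ` F) = lp1_value E w x"
    using x(1) max by (intro cSup_eq_maximum) auto
  thus ?thesis using x(1) max by auto
qed

lemma lp1_opt_attained:
  assumes "bij_betw s {1..n} S" "finite E" "E \<subseteq> S \<times> T"
  shows "\<exists>x. lp1_feasible s n T E d x \<and> lp1_value E w x = lp1_opt s n T E d w \<and>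
           (\<forall>y. lp1_feasible s n T E d y \<longrightarrow> lp1_value E w y \<le> lp1_value E w x)"
  using lp1_attained_aux[OF assms, of UNIV d w] by (auto simp: lp1_opt_def)

lemma lp1_int_opt_attained:
  assumes "bij_betw s {1..n} S" "finite E" "E \<subseteq> S \<times> T"
  shows "\<exists>x. lp1_feasible s n T E d x \<and> (\<forall>e\<in>E. x e \<in> \<int>) \<and>
           lp1_value E w x = lp1_int_opt s n T E d w \<and>
           (\<forall>y. lp1_feasible s n T E d y \<and> (\<forall>e\<in>E. y e \<in> \<int>) \<longrightarrow> lp1_value E w y \<le> lp1_value E w x)"
  using lp1_attained_aux[OF assms, of \<int> d w] by (auto simp: lp1_int_opt_def)

lemma max_weight_attained:
  assumes "finite E"
  shows "\<exists>M. distance_matching s n T E d M \<and> (\<Sum>e\<in>M. w e) = max_weight s n T E d w \<and>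
           (\<forall>N. distance_matching s n T E d N \<longrightarrow> (\<Sum>e\<in>N. w e) \<le> (\<Sum>e\<in>M. w e))"
proof -
  let ?W = "{\<Sum>e\<in>M. w e | M. distance_matching s n T E d M}"
  have "?W \<subseteq> sum w ` Pow E" by (auto simp: distance_matching_def)
  hence fin: "finite ?W" using assms by (meson finite_Pow_iff finite_imageI finite_subset)
  have "distance_matching s n T E d {}" by (simp add: distance_matching_def incident_def)
  hence "Max ?W \<in> ?W" using fin by (intro Max_in) auto
  then obtain M where "distance_matching s n T E d M" "(\<Sum>e\<in>M. w e) = Max ?W" by auto
  moreover have "(\<Sum>e\<in>N. w e) \<le> Max ?W" if "distance_matching s n T E d N" for N
    using fin that by (intro Max_ge) auto
  ultimately show ?thesis unfolding max_weight_def by metis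
qed

end

theory Submission
  imports Defs
begin

text \<open>
  For a feasible \<open>x\<close> and \<open>\<alpha> = 2 - 1 / (2 d - 1)\<close>, the vector \<open>x / \<alpha>\<close> is a convex combination of
  \<open>d\<close>-distance matchings, built by adding \<open>s\<^sub>1, \<dots>, s\<^sub>n\<close> one at a time. Given a random matching of the
  first \<open>k\<close> nodes with edge probabilities \<open>x / \<alpha>\<close>, the next node must choose an available \<open>t\<close> with
  probability \<open>x\<^sub>t / \<alpha>\<close>, where \<open>x\<^sub>t\<close> is the value of the edge from that node to \<open>t\<close>. By a fractional
  version of Hall's theorem, this is possible if every \<open>U \<subseteq> T\<close> contains an available node with
  probability at least \<open>\<Sum>\<^bsub>t\<in>U\<^esub> x\<^sub>t / \<alpha>\<close>. The last \<open>d - 1\<close> nodes block at most \<open>d - 1\<close> elements of \<open>T\<close>,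
  so only \<open>\<bar>U\<bar> < d\<close> matters; there the window constraint makes the \<open>t \<in> U\<close> with the largest
  \<open>x\<^sub>t\<close> available with probability at least \<open>1 - (1 - x\<^sub>t) / \<alpha>\<close>, which suffices because \<open>x\<^sub>t\<close> is
  at least the average over \<open>U\<close>.
\<close>

section \<open>A fractional version of Hall's theorem\<close>

text \<open>In transport terms \<open>p\<close> is a supply on \<open>A\<close>, \<open>y\<close> a
  demand on \<open>B\<close>, and \<open>R\<close> singles out the admissible pairs. Nonnegativity
  is bundled in so that the whole condition serves as the invariant of the induction in
  \<open>fractional_hall\<close>.\<close>

definition hall_condition ::
    "('c \<Rightarrow> 'b \<Rightarrow> bool) \<Rightarrow> 'c set \<Rightarrow> 'b set \<Rightarrow> ('c \<Rightarrow> real) \<Rightarrow> ('b \<Rightarrow> real) \<Rightarrow> bool" where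
  "hall_condition R A B p y \<longleftrightarrow>
     (\<forall>a\<in>A. 0 \<le> p a) \<and> (\<forall>b\<in>B. 0 \<le> y b) \<and>
     (\<forall>U\<subseteq>B. sum y U \<le> sum p {a\<in>A. \<exists>b\<in>U. R a b})"

text \<open>Demands are met exactly, while supplies may be left over: the leftover is the mass on
  which the next node will stay unmatched. The support clause ranges over all pairs, so the same
  \<open>q\<close> also works on larger \<open>A\<close> and \<open>B\<close>.\<close>

definition transport_plan ::
    "('c \<Rightarrow> 'b \<Rightarrow> bool) \<Rightarrow> 'c set \<Rightarrow> 'b set \<Rightarrow> ('c \<Rightarrow> real) \<Rightarrow> ('b \<Rightarrow> real) \<Rightarrow>
      ('c \<Rightarrow> 'b \<Rightarrow> real) \<Rightarrow> bool" where
  "transport_plan R A B p y q \<longleftrightarrow>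
     (\<forall>a b. 0 \<le> q a b) \<and> (\<forall>a b. q a b \<noteq> 0 \<longrightarrow> a \<in> A \<and> b \<in> B \<and> R a b) \<and>
     (\<forall>a\<in>A. (\<Sum>b\<in>B. q a b) \<le> p a) \<and> (\<forall>b\<in>B. (\<Sum>a\<in>A. q a b) = y b)"

text \<open>The demand of \<open>U\<close> exhausts the supply of its neighbourhood
  \<open>A'\<close>. For \<open>V\<close> outside \<open>U\<close>, subtracting this equality from
  the condition for \<open>V \<union> U\<close> leaves the condition for \<open>V\<close> with the
  supplies outside \<open>A'\<close>.\<close>

lemma hall_condition_tight_parts:
  assumes fin: "finite A" "finite B" and H: "hall_condition R A B p y"
    and U: "U \<subseteq> B" and A': "A' = {a\<in>A. \<exists>b\<in>U. R a b}" and tight: "sum y U = sum p A'"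
  shows "hall_condition R A' U p y" "hall_condition R (A - A') (B - U) p y"
proof -
  have "{a\<in>A'. \<exists>b\<in>V. R a b} = {a\<in>A. \<exists>b\<in>V. R a b}" if "V \<subseteq> U" for V
    using that A' by auto
  then show "hall_condition R A' U p y"
    using H U A' unfolding hall_condition_def by (simp add: subset_iff)
  have "sum y V \<le> sum p {a\<in>A - A'. \<exists>b\<in>V. R a b}" if V: "V \<subseteq> B - U" for V
  proof -
    let ?N = "{a\<in>A - A'. \<exists>b\<in>V. R a b}"
    have "{a\<in>A. \<exists>b\<in>V \<union> U. R a b} = ?N \<union> A'" using A' by auto
    then have "sum y (V \<union> U) \<le> sum p (?N \<union> A')"
      using H V U unfolding hall_condition_def by (metis Diff_subset Un_subset_iff order_trans)
    moreover have "sum y (V \<union> U) = sum y V + sum y U"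
      using V U fin by (intro sum.union_disjoint) (auto intro: finite_subset)
    moreover have "sum p (?N \<union> A') = sum p ?N + sum p A'"
      using A' fin by (intro sum.union_disjoint) auto
    ultimately show ?thesis using tight by simp
  qed
  then show "hall_condition R (A - A') (B - U) p y"
    using H unfolding hall_condition_def by simp
qed

text \<open>As \<open>q\<close> vanishes off \<open>A'\<close> and \<open>B'\<close>, enlarging the
  index sets changes no sum; added demands must therefore be zero, added supplies only
  nonnegative.\<close>

lemma transport_plan_mono:
  assumes q: "transport_plan R A' B' p y q" and fin: "finite A" "finite B"
    and sub: "A' \<subseteq> A" "B' \<subseteq> B" and p: "\<forall>a\<in>A. 0 \<le> p a" and y: "\<forall>b\<in>B - B'. y b = 0"
  shows "transport_plan R A B p y q"
proof -
  have z: "q a b = 0" if "a \<notin> A' \<or> b \<notin> B'" for a b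
    using q that unfolding transport_plan_def by blast
  have "(\<Sum>b\<in>B. q a b) = (\<Sum>b\<in>B'. q a b)" for a
    using z fin sub by (intro sum.mono_neutral_right) auto
  moreover have "(\<Sum>a\<in>A. q a b) = (\<Sum>a\<in>A'. q a b)" for b
    using z fin sub by (intro sum.mono_neutral_right) auto
  moreover have "(\<Sum>b\<in>B'. q a b) \<le> p a" if "a \<in> A" for a
  proof (cases "a \<in> A'")
    case True
    then show ?thesis using q by (simp add: transport_plan_def)
  next
    case False
    then have "(\<Sum>b\<in>B'. q a b) = 0" by (simp add: z)
    then show ?thesis using p that by simp
  qed
  moreover have "(\<Sum>a\<in>A'. q a b) = y b" if "b \<in> B" for b
  proof (cases "b \<in> B'")
    case True
    then show ?thesis using q by (simp add: transport_plan_def)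
  next
    case False
    then have "(\<Sum>a\<in>A'. q a b) = 0" by (simp add: z)
    then show ?thesis using y that False by simp
  qed
  moreover have "\<forall>a b. 0 \<le> q a b" "\<forall>a b. q a b \<noteq> 0 \<longrightarrow> a \<in> A \<and> b \<in> B \<and> R a b"
    using q sub unfolding transport_plan_def by blast+
  ultimately show ?thesis
    unfolding transport_plan_def by simp
qed

lemma transport_plan_add:
  assumes q: "transport_plan R A B p y q" and q': "transport_plan R A B p' y' q'"
  shows "transport_plan R A B (\<lambda>a. p a + p' a) (\<lambda>b. y b + y' b) (\<lambda>a b. q a b + q' a b)"
proof -
  have "a \<in> A \<and> b \<in> B \<and> R a b" if "q a b + q' a b \<noteq> 0" for a b
  proof -
    have "q a b \<noteq> 0 \<or> q' a b \<noteq> 0" using that by auto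
    then show ?thesis using assms unfolding transport_plan_def by blast
  qed
  then show ?thesis
    using assms unfolding transport_plan_def sum.distrib
    by (simp add: add_mono)
qed

lemma transport_plan_cong:
  assumes "\<And>a. a \<in> A \<Longrightarrow> p a = p' a" "\<And>b. b \<in> B \<Longrightarrow> y b = y' b"
  shows "transport_plan R A B p y q \<longleftrightarrow> transport_plan R A B p' y' q"
  using assms unfolding transport_plan_def by auto

lemma transport_plan_tight_union:
  assumes fin: "finite A" "finite B" and p: "\<forall>a\<in>A. 0 \<le> p a" and sub: "A' \<subseteq> A" "B' \<subseteq> B"
    and q1: "transport_plan R A' B' p y q1" and q2: "transport_plan R (A - A') (B - B') p y q2"
  shows "transport_plan R A B p y (\<lambda>a b. q1 a b + q2 a b)"
proof -
  \<comment> \<open>Cutting \<open>p\<close> and \<open>y\<close> down to the two halves makes the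
    demands outside each half zero, as \<open>transport_plan_mono\<close> requires; the halves add
    up to \<open>p\<close> and \<open>y\<close> again.\<close>
  define p1 p2 y1 y2 where "p1 = (\<lambda>a. if a \<in> A' then p a else 0)"
    and "p2 = (\<lambda>a. if a \<in> A' then 0 else p a)"
    and "y1 = (\<lambda>b. if b \<in> B' then y b else 0)" and "y2 = (\<lambda>b. if b \<in> B' then 0 else y b)"
  have "transport_plan R A B p1 y1 q1"
  proof (rule transport_plan_mono[OF _ fin sub])
    show "transport_plan R A' B' p1 y1 q1"
      using q1 transport_plan_cong[of A' p p1 B' y y1] by (simp add: p1_def y1_def)
  qed (use p in \<open>auto simp: p1_def y1_def\<close>)
  moreover have "transport_plan R A B p2 y2 q2"
  proof (rule transport_plan_mono[OF _ fin, of _ "A - A'" "B - B'"])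
    show "transport_plan R (A - A') (B - B') p2 y2 q2"
      using q2 transport_plan_cong[of "A - A'" p p2 "B - B'" y y2] by (simp add: p2_def y2_def)
  qed (use p in \<open>auto simp: p2_def y2_def\<close>)
  moreover have "(\<lambda>a. p1 a + p2 a) = p" "(\<lambda>b. y1 b + y2 b) = y"
    by (auto simp: p1_def p2_def y1_def y2_def)
  ultimately show ?thesis using transport_plan_add[of R A B p1 y1 q1 p2 y2 q2] by simp
qed

text \<open>
  Move mass along one admissible pair until the supply or the demand of that pair is exhausted, or
  a set of demands becomes tight; a tight set splits the problem into two independent ones.
\<close>

lemma fractional_hall:
  assumes "finite A" "finite B" "hall_condition R A B p y"
  shows "\<exists>q. transport_plan R A B p y q"
  using assms
proof (induction "card A + card B" arbitrary: A B p y rule: less_induct)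
  case less
  note fin = less.prems(1,2) and H = less.prems(3)
  have p0: "\<forall>a\<in>A. 0 \<le> p a" and y0: "\<forall>b\<in>B. 0 \<le> y b"
    and hall: "\<And>U. U \<subseteq> B \<Longrightarrow> sum y U \<le> sum p {a\<in>A. \<exists>b\<in>U. R a b}"
    using H by (auto simp: hall_condition_def)
  show ?case
  proof (cases "\<forall>b\<in>B. y b = 0")
    case True
    then have "transport_plan R A B p y (\<lambda>_ _. 0)"
      using p0 by (auto simp: transport_plan_def)
    then show ?thesis by blast
  next
    case False
    then obtain t where t: "t \<in> B" "y t > 0" using y0 by force
    have "0 < sum p {a\<in>A. \<exists>b\<in>{t}. R a b}"
      using hall[of "{t}"] t by simp
    then have "\<not> (\<forall>a\<in>{a\<in>A. \<exists>b\<in>{t}. R a b}. p a \<le> 0)"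
      using sum_nonpos[of "{a\<in>A. \<exists>b\<in>{t}. R a b}" p] by force
    then obtain c where c: "c \<in> A" "R c t" "p c > 0"
      by (auto simp: not_le)
    define slack where "slack U = sum p {a\<in>A. \<exists>b\<in>U. R a b} - sum y U" for U
    \<comment> \<open>Moving mass along \<open>(c, t)\<close> can lower the slack of these sets
      only: a set containing \<open>t\<close> sees \<open>c\<close> as well and loses the same
      amount on both sides.\<close>
    define F where "F = {U. U \<subseteq> B - {t} \<and> (\<exists>b\<in>U. R c b)}"
    define X where "X = {p c, y t} \<union> slack ` F"
    \<comment> \<open>The largest transfer that keeps the supply of \<open>c\<close>, the demand of
      \<open>t\<close> and every slack nonnegative. Being attained in \<open>X\<close>, it makes one
      of these quantities vanish.\<close>
    define \<epsilon> where "\<epsilon> = Min X"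
    have finX: "finite X" using fin by (auto simp: X_def F_def)
    have "\<epsilon> \<in> X" unfolding \<epsilon>_def using finX by (intro Min_in) (auto simp: X_def)
    have eps_le: "\<epsilon> \<le> v" if "v \<in> X" for v
      unfolding \<epsilon>_def using finX that by (intro Min_le)
    have "0 \<le> v" if "v \<in> X" for v
    proof -
      have "0 \<le> slack U" if "U \<in> F" for U
        using that hall[of U] by (auto simp: F_def slack_def)
      then show ?thesis using that t c by (auto simp: X_def)
    qed
    then have eps0: "0 \<le> \<epsilon>" using \<open>\<epsilon> \<in> X\<close> by blast
    define p' where "p' = (\<lambda>a. p a - (if a = c then \<epsilon> else 0))"
    define y' where "y' = (\<lambda>b. y b - (if b = t then \<epsilon> else 0))"
    have sum_p': "sum p' {a\<in>A. \<exists>b\<in>U. R a b} =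
        sum p {a\<in>A. \<exists>b\<in>U. R a b} - (if \<exists>b\<in>U. R c b then \<epsilon> else 0)" for U
      using fin c by (simp add: p'_def sum_subtractf)
    have sum_y': "sum y' U = sum y U - (if t \<in> U then \<epsilon> else 0)" if "U \<subseteq> B" for U
      using finite_subset[OF that fin(2)] by (simp add: y'_def sum_subtractf)
    have H': "hall_condition R A B p' y'"
      unfolding hall_condition_def
    proof (intro conjI ballI allI impI)
      show "0 \<le> p' a" if "a \<in> A" for a
        using p0 that eps_le[of "p c"] by (auto simp: p'_def X_def)
      show "0 \<le> y' b" if "b \<in> B" for b
        using y0 that eps_le[of "y t"] by (auto simp: y'_def X_def)
      fix U assume U: "U \<subseteq> B"
      have "\<epsilon> \<le> slack U" if "t \<notin> U" "\<exists>b\<in>U. R c b"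
        using that U by (intro eps_le) (auto simp: X_def F_def)
      then show "sum y' U \<le> sum p' {a\<in>A. \<exists>b\<in>U. R a b}"
        using hall[OF U] eps0 c(2) unfolding sum_p' sum_y'[OF U] slack_def by (smt (verit))
    qed
    have "\<exists>q. transport_plan R A B p' y' q"
    proof -
      consider "\<epsilon> = p c" | "\<epsilon> = y t" | U where "U \<in> F" "\<epsilon> = slack U"
        using \<open>\<epsilon> \<in> X\<close> by (auto simp: X_def)
      then show ?thesis
      proof cases
        case 1
        then have pc: "p' c = 0" by (simp add: p'_def)
        have "sum p' {a\<in>A - {c}. \<exists>b\<in>U. R a b} = sum p' {a\<in>A. \<exists>b\<in>U. R a b}" for U
          using fin pc by (intro sum.mono_neutral_left) auto
        then have "hall_condition R (A - {c}) B p' y'"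
          using H' by (auto simp: hall_condition_def)
        moreover have "card (A - {c}) + card B < card A + card B"
          using card_Diff1_less[OF fin(1) c(1)] by simp
        ultimately obtain q where "transport_plan R (A - {c}) B p' y' q"
          using less.hyps[of "A - {c}" B p' y', OF _ finite_Diff[OF fin(1)] fin(2)] by blast
        then have "transport_plan R A B p' y' q"
          using H' by (intro transport_plan_mono[OF _ fin, of _ "A - {c}" B]) (auto simp: hall_condition_def)
        then show ?thesis by blast
      next
        case 2
        then have yt: "y' t = 0" by (simp add: y'_def)
        have "hall_condition R A (B - {t}) p' y'"
          using H' unfolding hall_condition_def by blast
        moreover have "card A + card (B - {t}) < card A + card B"
          using card_Diff1_less[OF fin(2) t(1)] by simp
        ultimately obtain q where "transport_plan R A (B - {t}) p' y' q"
          using less.hyps[of A "B - {t}" p' y', OF _ fin(1) finite_Diff[OF fin(2)]] by blast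
        then have "transport_plan R A B p' y' q"
          using H' yt by (intro transport_plan_mono[OF _ fin, of _ A "B - {t}"]) (auto simp: hall_condition_def)
        then show ?thesis by blast
      next
        case (3 U)
        define A' where "A' = {a\<in>A. \<exists>b\<in>U. R a b}"
        have U: "U \<subseteq> B" "t \<notin> U" "\<exists>b\<in>U. R c b" using 3 by (auto simp: F_def)
        have tight: "sum y' U = sum p' A'"
          using 3 U sum_y'[OF U(1)] sum_p'[of U] by (simp add: slack_def A'_def)
        note parts = hall_condition_tight_parts[OF fin H' U(1) A'_def tight]
        have finU: "finite U" using U(1) fin finite_subset by blast
        have A'A: "A' \<subseteq> A" by (auto simp: A'_def)
        \<comment> \<open>\<open>U\<close> omits \<open>t\<close> and is nonempty, so both halves
          have strictly fewer demands and the induction measure drops.\<close>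
        have "U \<subset> B" "B - U \<subset> B" using U t by auto
        then have less_card: "card U < card B" "card (B - U) < card B"
          using fin by (simp_all add: psubset_card_mono)
        have "card A' \<le> card A" "card (A - A') \<le> card A"
          using fin A'A by (auto intro: card_mono)
        then have "card A' + card U < card A + card B"
            "card (A - A') + card (B - U) < card A + card B"
          using less_card by linarith+
        then obtain q1 q2 where "transport_plan R A' U p' y' q1"
            "transport_plan R (A - A') (B - U) p' y' q2"
          using less.hyps[OF _ finite_subset[OF A'A fin(1)] finU parts(1)]
            less.hyps[OF _ finite_Diff[OF fin(1)] finite_Diff[OF fin(2)] parts(2)] by blast
        then have "transport_plan R A B p' y' (\<lambda>a b. q1 a b + q2 a b)"
          using H' by (intro transport_plan_tight_union[OF fin _ A'A U(1)]) (auto simp: hall_condition_def)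
        then show ?thesis by blast
      qed
    qed
    then obtain q where q: "transport_plan R A B p' y' q" ..
    \<comment> \<open>Put the transferred amount back on the pair \<open>(c, t)\<close>.\<close>
    let ?d = "\<lambda>a b. if a = c \<and> b = t then \<epsilon> else 0"
    have d1: "(\<Sum>b\<in>B. ?d a b) = (if a = c then \<epsilon> else 0)" for a
      using t fin by (cases "a = c") auto
    have d2: "(\<Sum>a\<in>A. ?d a b) = (if b = t then \<epsilon> else 0)" for b
      using c fin by (cases "b = t") auto
    have "transport_plan R A B (\<lambda>a. if a = c then \<epsilon> else 0) (\<lambda>b. if b = t then \<epsilon> else 0) ?d"
      using eps0 c t unfolding transport_plan_def d1 d2 by auto
    from transport_plan_add[OF q this]
    have "transport_plan R A B p y (\<lambda>a b. q a b + ?d a b)"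
      by (simp add: p'_def y'_def)
    then show ?thesis by blast
  qed
qed

section \<open>Decomposing scaled feasible vectors\<close>

definition matchings_upto ::
    "(nat \<Rightarrow> 'a) \<Rightarrow> nat \<Rightarrow> 'b set \<Rightarrow> ('a \<times> 'b) set \<Rightarrow> nat \<Rightarrow> nat \<Rightarrow> ('a \<times> 'b) set set" where
  "matchings_upto s n T E d k = {M. distance_matching s n T E d M \<and> fst ` M \<subseteq> s ` {1..k}}"

lemma finite_matchings_upto: "finite E \<Longrightarrow> finite (matchings_upto s n T E d k)"
  by (rule finite_subset[of _ "Pow E"]) (auto simp: matchings_upto_def distance_matching_def)

lemma new_row_notin:
  assumes "inj_on s {1..n}" "k < n" "M \<in> matchings_upto s n T E d k"
  shows "(s (Suc k), t) \<notin> M"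
proof
  assume "(s (Suc k), t) \<in> M"
  then obtain j where "j \<in> {1..k}" "s (Suc k) = s j"
    using assms(3) unfolding matchings_upto_def by force
  then show False using inj_onD[OF assms(1), of "Suc k" j] assms(2) by auto
qed

text \<open>The new node comes last, so only earlier holders of \<open>t\<close> can conflict with
  it, and \<open>j + d \<le> Suc k\<close> says that such a holder is far enough away.\<close>

lemma matchings_upto_insert:
  assumes inj: "inj_on s {1..n}" and k: "k < n" and M: "M \<in> matchings_upto s n T E d k"
    and e: "(s (Suc k), t) \<in> E"
    and free: "\<forall>j\<in>{1..k}. (s j, t) \<in> M \<longrightarrow> j + d \<le> Suc k"
  shows "insert (s (Suc k), t) M \<in> matchings_upto s n T E d (Suc k)"
proof -
  let ?M = "insert (s (Suc k), t) M"
  have s_eq: "s i = s j \<longleftrightarrow> i = j" if "i \<in> {1..n}" "j \<in> {1..n}" for i j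
    using inj_on_eq_iff[OF inj] that by blast
  have dm: "M \<subseteq> E" "\<And>i. i \<in> {1..n} \<Longrightarrow> card (incident M (s i)) \<le> 1"
    "\<And>i j u. \<lbrakk>i \<in> {1..n}; j \<in> {1..n}; u \<in> T; i \<noteq> j; (s i, u) \<in> M; (s j, u) \<in> M\<rbrakk>
       \<Longrightarrow> int d \<le> \<bar>int j - int i\<bar>"
    and rows: "fst ` M \<subseteq> s ` {1..k}"
    using M by (auto simp: matchings_upto_def distance_matching_def)
  note new = new_row_notin[OF inj k M]
  have row: "i \<in> {1..k}" if "(s i, u) \<in> M" "i \<in> {1..n}" for i u
  proof -
    have "s i \<in> s ` {1..k}" using that(1) rows by force
    then obtain j where "j \<in> {1..k}" "s i = s j" by blast
    then show ?thesis using s_eq[of i j] that(2) k by auto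
  qed
  have "card (incident ?M (s i)) \<le> 1" if i: "i \<in> {1..n}" for i
  proof (cases "i = Suc k")
    case True
    then have "incident ?M (s i) = {(s (Suc k), t)}"
      using new by (auto simp: incident_def)
    then show ?thesis by simp
  next
    case False
    then have "incident ?M (s i) = incident M (s i)"
      using s_eq[of i "Suc k"] i k by (auto simp: incident_def)
    then show ?thesis using dm(2) i by simp
  qed
  moreover have "int d \<le> \<bar>int j - int i\<bar>"
    if ij: "i \<in> {1..n}" "j \<in> {1..n}" "u \<in> T" "i \<noteq> j" "(s i, u) \<in> ?M" "(s j, u) \<in> ?M" for i j u
  proof -
    have mem: "(s l, u) \<in> M \<or> (l = Suc k \<and> u = t)" if "(s l, u) \<in> ?M" "l \<in> {1..n}" for l
      using that s_eq[of l "Suc k"] k by auto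
    have far: "int d \<le> \<bar>int (Suc k) - int l\<bar>" if "(s l, t) \<in> M" "l \<in> {1..n}" for l
      using free row[OF that] that(1) by fastforce
    show ?thesis
      using mem[OF ij(5,1)] mem[OF ij(6,2)] ij far[of i] far[of j] dm(3)[of i j u]
      by (auto simp: abs_minus_commute)
  qed
  ultimately show ?thesis
    using dm(1) e rows unfolding matchings_upto_def distance_matching_def by auto
qed

lemma card_blocked_le:
  assumes fin: "finite E" and k: "k < n" and M: "distance_matching s n T E d M"
  shows "card {t. \<exists>j\<in>{1..k}. (s j, t) \<in> M \<and> Suc k < j + d} \<le> d - 1"
proof -
  define J where "J = {j\<in>{1..k}. Suc k < j + d}"
  have finM: "finite M" using M fin finite_subset by (auto simp: distance_matching_def)
  have "{t. \<exists>j\<in>{1..k}. (s j, t) \<in> M \<and> Suc k < j + d} = (\<Union>j\<in>J. snd ` incident M (s j))"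
    by (force simp: J_def incident_def)
  moreover have "card (\<Union>j\<in>J. snd ` incident M (s j)) \<le> (\<Sum>j\<in>J. card (snd ` incident M (s j)))"
    by (rule card_UN_le) (simp add: J_def)
  moreover have "(\<Sum>j\<in>J. card (snd ` incident M (s j))) \<le> (\<Sum>j\<in>J. 1)"
  proof (rule sum_mono)
    fix j assume "j \<in> J"
    then have "card (incident M (s j)) \<le> 1"
      using M k by (auto simp: J_def distance_matching_def)
    moreover have "card (snd ` incident M (s j)) \<le> card (incident M (s j))"
      using finM by (intro card_image_le) (simp add: incident_def)
    ultimately show "card (snd ` incident M (s j)) \<le> 1" by linarith
  qed
  \<comment> \<open>The range starts at \<open>Suc k - (d - 1)\<close> when \<open>d\<close> is
    positive, so it has at most \<open>d - 1\<close> members; for \<open>d = 0\<close> it is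
    empty.\<close>
  moreover have "card J \<le> card {Suc (Suc k) - d..k}"
    by (rule card_mono) (auto simp: J_def)
  ultimately show ?thesis by (cases "d = 0") (auto simp: J_def)
qed

lemma lp1_window_sum:
  assumes inj: "inj_on s {1..n}" and x: "lp1_feasible s n T E d x" and fin: "finite E"
    and k: "k < n" and t: "t \<in> T" and e: "(s (Suc k), t) \<in> E" and x1: "x (s (Suc k), t) \<le> 1"
  shows "(\<Sum>j | j \<in> {1..k} \<and> Suc k < j + d \<and> (s j, t) \<in> E. x (s j, t)) + x (s (Suc k), t) \<le> 1"
\<comment> \<open>For \<open>d = 0\<close> windows are empty and the LP constraint says nothing, so
  the bound comes from \<open>x1\<close>.\<close>
proof (cases "d = 0")
  case True
  then have "(\<Sum>j | j \<in> {1..k} \<and> Suc k < j + d \<and> (s j, t) \<in> E. x (s j, t)) = 0"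
    by (intro sum.neutral) auto
  then show ?thesis using x1 by linarith
next
  case False
  define J where "J = {j. j \<in> {1..k} \<and> Suc k < j + d \<and> (s j, t) \<in> E}"
  \<comment> \<open>Start of the \<open>d\<close> consecutive indices ending at
    \<open>Suc k\<close>, moved up to 1 if it falls before the first node. The window may then reach
    past \<open>Suc k\<close>, which only adds nonnegative terms.\<close>
  define i where "i = max 1 (Suc (Suc k) - d)"
  have i: "i \<in> {1..n}" using k False by (auto simp: i_def)
  let ?W = "{v. v \<in> window s n d i \<and> (v, t) \<in> E}"
  have "insert (Suc k) J \<subseteq> {i..min (i + d - 1) n}"
    using k False by (auto simp: J_def i_def)
  then have sub: "s ` insert (Suc k) J \<subseteq> ?W"
    using e unfolding window_def by (auto simp: J_def)
  have "finite ?W" by (rule finite_subset[of _ "window s n d i"]) (auto simp: window_def)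
  then have "(\<Sum>v\<in>s ` insert (Suc k) J. x (v, t)) \<le> (\<Sum>v\<in>?W. x (v, t))"
    using sub x by (intro sum_mono2) (auto simp: lp1_feasible_def)
  also have "\<dots> \<le> 1" using x i t by (auto simp: lp1_feasible_def)
  also have "(\<Sum>v\<in>s ` insert (Suc k) J. x (v, t)) = (\<Sum>j\<in>insert (Suc k) J. x (s j, t))"
  proof -
    have "inj_on s (insert (Suc k) J)"
      by (rule inj_on_subset[OF inj]) (use k in \<open>auto simp: J_def\<close>)
    then show ?thesis by (simp add: sum.reindex del: image_insert sum.insert)
  qed
  also have "\<dots> = x (s (Suc k), t) + (\<Sum>j\<in>J. x (s j, t))"
    by (subst sum.insert) (auto simp: J_def)
  finally show ?thesis by (simp add: J_def)
qed

section \<open>Convex combinations of matchings\<close>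

text \<open>A convex combination read as a random matching: \<open>p M\<close> is the probability of
  \<open>M\<close>, and \<open>y\<close> gives the edge marginals. Restricting them to
  \<open>F\<close> leaves the rows not yet processed free.\<close>

definition decomposes :: "('a \<times> 'b) set set \<Rightarrow> (('a \<times> 'b) set \<Rightarrow> real) \<Rightarrow> ('a \<times> 'b) set \<Rightarrow>
    ('a \<times> 'b \<Rightarrow> real) \<Rightarrow> bool" where
  "decomposes \<M> p F y \<longleftrightarrow>
     (\<forall>M\<in>\<M>. 0 \<le> p M) \<and> sum p \<M> = 1 \<and> (\<forall>e\<in>F. (\<Sum>M\<in>\<M>. p M * of_bool (e \<in> M)) = y e)"

text \<open>For \<open>d \<ge> 2\<close> the second condition on \<open>\<alpha>\<close> reads
  \<open>\<alpha> \<ge> 2 - 1 / (d - 1)\<close>; it enters for sets \<open>U\<close> with fewer than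
  \<open>d\<close> elements.\<close>

lemma hall_condition_new_row:
  fixes \<alpha> :: real
  assumes inj: "inj_on s {1..n}" and fin: "finite E" "finite T" and k: "k < n"
    and x: "lp1_feasible s n T E d x"
    and \<alpha>: "1 \<le> \<alpha>" "real (d - 1) * (2 - \<alpha>) \<le> 1"
    and p: "decomposes (matchings_upto s n T E d k) p {e\<in>E. fst e \<in> s ` {1..k}} (\<lambda>e. x e / \<alpha>)"
  shows "hall_condition (\<lambda>M t. \<forall>j\<in>{1..k}. (s j, t) \<in> M \<longrightarrow> j + d \<le> Suc k)
    (matchings_upto s n T E d k) {t\<in>T. (s (Suc k), t) \<in> E} p (\<lambda>t. x (s (Suc k), t) / \<alpha>)"
proof -
  define \<Omega> where "\<Omega> = matchings_upto s n T E d k"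
  define N where "N = {t\<in>T. (s (Suc k), t) \<in> E}"
  define R where "R = (\<lambda>(M :: ('a \<times> 'b) set) t. \<forall>j\<in>{1..k}. (s j, t) \<in> M \<longrightarrow> j + d \<le> Suc k)"
  define z where "z = (\<lambda>t. x (s (Suc k), t))"
  have fin\<Omega>: "finite \<Omega>" and finN: "finite N"
    using fin finite_matchings_upto by (auto simp: \<Omega>_def N_def)
  have p0: "\<And>M. M \<in> \<Omega> \<Longrightarrow> 0 \<le> p M" and p1: "sum p \<Omega> = 1"
    and pm: "\<And>e. \<lbrakk>e \<in> E; fst e \<in> s ` {1..k}\<rbrakk> \<Longrightarrow> (\<Sum>M\<in>\<Omega>. p M * of_bool (e \<in> M)) = x e / \<alpha>"
    using p by (auto simp: decomposes_def \<Omega>_def)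
  have z0: "0 \<le> z t" if "t \<in> N" for t
    using x that by (auto simp: lp1_feasible_def z_def N_def)
  have zsum: "sum z U \<le> 1" if "U \<subseteq> N" for U
  proof -
    have "sum z U = sum x (Pair (s (Suc k)) ` U)"
      by (subst sum.reindex) (auto simp: z_def inj_on_def)
    also have "\<dots> \<le> sum x (incident E (s (Suc k)))"
      using that fin x by (intro sum_mono2) (auto simp: N_def incident_def lp1_feasible_def)
    also have "\<dots> \<le> 1" using x k by (auto simp: lp1_feasible_def)
    finally show ?thesis .
  qed
  have avail: "1 - (1 - z t) / \<alpha> \<le> sum p {M\<in>\<Omega>. R M t}" if t: "t \<in> N" for t
  proof -
    define J where "J = {j. j \<in> {1..k} \<and> Suc k < j + d \<and> (s j, t) \<in> E}"
    have finJ: "finite J" by (simp add: J_def)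
    have "sum p {M\<in>\<Omega>. \<not> R M t} \<le> (\<Sum>M\<in>\<Omega>. \<Sum>j\<in>J. p M * of_bool ((s j, t) \<in> M))"
      unfolding sum.inter_filter[OF fin\<Omega>]
    proof (rule sum_mono)
      fix M assume M: "M \<in> \<Omega>"
      show "(if \<not> R M t then p M else 0) \<le> (\<Sum>j\<in>J. p M * of_bool ((s j, t) \<in> M))"
      proof (cases "R M t")
        case True
        then show ?thesis using p0[OF M] by (auto intro: sum_nonneg)
      next
        case False
        then obtain j where "j \<in> {1..k}" "(s j, t) \<in> M" "Suc k < j + d"
          unfolding R_def by force
        moreover have "M \<subseteq> E"
          using M by (auto simp: \<Omega>_def matchings_upto_def distance_matching_def)
        ultimately have "j \<in> J" "(s j, t) \<in> M" by (auto simp: J_def)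
        then show ?thesis
          using False p0[OF M] finJ member_le_sum[of j J "\<lambda>j. p M * of_bool ((s j, t) \<in> M)"]
          by simp
      qed
    qed
    also have "\<dots> = (\<Sum>j\<in>J. x (s j, t) / \<alpha>)"
      by (subst sum.swap, rule sum.cong) (auto simp: J_def intro!: pm)
    also have "\<dots> = (\<Sum>j\<in>J. x (s j, t)) / \<alpha>" by (simp add: sum_divide_distrib)
    also have "\<dots> \<le> (1 - z t) / \<alpha>"
      using lp1_window_sum[OF inj x fin(1) k, of t] t zsum[of "{t}"] \<alpha>(1)
      by (intro divide_right_mono) (auto simp: J_def N_def z_def)
    finally have "sum p {M\<in>\<Omega>. \<not> R M t} \<le> (1 - z t) / \<alpha>" .
    moreover have "sum p \<Omega> = sum p {M\<in>\<Omega>. R M t} + sum p {M\<in>\<Omega>. \<not> R M t}"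
      using fin\<Omega> by (subst sum.union_disjoint[symmetric]) (auto intro: sum.cong)
    ultimately show ?thesis using p1 by linarith
  qed
  have "(\<Sum>t\<in>U. z t / \<alpha>) \<le> sum p {M\<in>\<Omega>. \<exists>t\<in>U. R M t}" if U: "U \<subseteq> N" for U
  proof (cases "U = {}")
    case False
    have finU: "finite U" using U finN finite_subset by blast
    show ?thesis
    proof (cases "d \<le> card U")
      case True
      have "\<exists>t\<in>U. R M t" if M: "M \<in> \<Omega>" for M
      proof (rule ccontr)
        let ?X = "{t. \<exists>j\<in>{1..k}. (s j, t) \<in> M \<and> Suc k < j + d}"
        assume "\<not> (\<exists>t\<in>U. R M t)"
        then have sub: "U \<subseteq> ?X" by (force simp: R_def)
        have dm: "distance_matching s n T E d M"
          using M by (simp add: \<Omega>_def matchings_upto_def)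
        have "finite M" using dm fin(1) finite_subset by (auto simp: distance_matching_def)
        then have "finite ?X" by (rule finite_subset[rotated, OF finite_imageI[of _ snd]]) force
        then have "card U \<le> d - 1"
          using card_mono[OF _ sub] card_blocked_le[OF fin(1) k dm] by linarith
        \<comment> \<open>For \<open>d = 0\<close> truncated subtraction turns the previous bound
          into \<open>card U \<le> 0\<close>, so nonemptiness is what contradicts it.\<close>
        moreover have "0 < card U" using finU False by (simp add: card_gt_0_iff)
        ultimately show False using True by linarith
      qed
      then have "{M\<in>\<Omega>. \<exists>t\<in>U. R M t} = \<Omega>" by auto
      moreover have "sum z U / \<alpha> \<le> 1" using zsum[OF U] \<alpha>(1) by simp
      ultimately show ?thesis using p1 by (simp add: sum_divide_distrib)
    next
      case less: False
      define m where "m = Max (z ` U)"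
      have "m \<in> z ` U" unfolding m_def using finU False by (intro Max_in) auto
      then obtain t where t: "t \<in> U" "z t = m" by auto
      have "sum z U \<le> real (card U) * m"
        using finU by (intro sum_bounded_above) (simp add: m_def)
      also have "\<dots> \<le> real (d - 1) * m"
        using less z0[of t] t U by (intro mult_right_mono) auto
      finally have am: "sum z U \<le> real (d - 1) * m" .
      \<comment> \<open>This is \<open>sum z U / \<alpha> \<le> 1 - (1 - m) / \<alpha>\<close>
        cleared of denominators. A large \<open>m\<close> settles it through
        \<open>sum z U \<le> 1\<close>; otherwise \<open>m\<close> is compared with the
        average.\<close>
      have "sum z U + 1 - m \<le> \<alpha>"
      proof (cases "2 - \<alpha> \<le> m")
        case True
        then show ?thesis using zsum[OF U] by linarith
      next
        case small: False
        have d1: "1 \<le> real (d - 1)"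
        proof -
          have "card U \<noteq> 0" using finU False by simp
          then show ?thesis using less by linarith
        qed
        \<comment> \<open>Since \<open>m\<close> is at least \<open>sum z U / (d - 1)\<close>,
          removing it leaves at most the fraction \<open>1 - 1 / (d - 1)\<close> of a sum bounded by
          1.\<close>
        have "real (d - 1) * (sum z U - m) \<le> (real (d - 1) - 1) * sum z U"
          using am by (simp add: algebra_simps)
        also have "\<dots> \<le> (real (d - 1) - 1) * 1"
          using d1 zsum[OF U] by (intro mult_left_mono) auto
        also have "\<dots> \<le> real (d - 1) * (\<alpha> - 1)"
          using \<alpha>(2) by (simp add: algebra_simps)
        finally have "sum z U - m \<le> \<alpha> - 1"
          using d1 by (simp add: mult_le_cancel_left_pos)
        then show ?thesis by linarith
      qed
      then have "(sum z U + 1 - m) / \<alpha> \<le> 1" using \<alpha>(1) by simp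
      then have "sum z U / \<alpha> \<le> 1 - (1 - z t) / \<alpha>"
        using t by (simp add: diff_divide_distrib add_divide_distrib)
      also have "\<dots> \<le> sum p {M\<in>\<Omega>. R M t}" using avail t U by blast
      also have "\<dots> \<le> sum p {M\<in>\<Omega>. \<exists>t\<in>U. R M t}"
        using fin\<Omega> p0 t by (intro sum_mono2) auto
      finally show ?thesis by (simp add: sum_divide_distrib)
    qed
  qed simp
  then show ?thesis
    using p0 z0 \<alpha>(1) unfolding hall_condition_def
    by (simp add: \<Omega>_def N_def R_def z_def)
qed

text \<open>Read \<open>q M t\<close> as the probability of drawing \<open>M\<close> and then
  matching the new node to \<open>t\<close>. The law of the resulting matching has the old marginals
  on old rows and the column sums of \<open>q\<close> on the new row.\<close>

lemma decomposes_Suc: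
  assumes inj: "inj_on s {1..n}" and fin: "finite E" "finite T" and E: "snd ` E \<subseteq> T" and k: "k < n"
    and p: "decomposes (matchings_upto s n T E d k) p {e\<in>E. fst e \<in> s ` {1..k}} y"
    and q: "transport_plan (\<lambda>M t. \<forall>j\<in>{1..k}. (s j, t) \<in> M \<longrightarrow> j + d \<le> Suc k)
      (matchings_upto s n T E d k) {t\<in>T. (s (Suc k), t) \<in> E} p (\<lambda>t. y (s (Suc k), t)) q"
  shows "\<exists>p'. decomposes (matchings_upto s n T E d (Suc k)) p' {e\<in>E. fst e \<in> s ` {1..Suc k}} y"
proof -
  define \<Omega> \<Omega>' where "\<Omega> = matchings_upto s n T E d k" and "\<Omega>' = matchings_upto s n T E d (Suc k)"
  define N where "N = {t\<in>T. (s (Suc k), t) \<in> E}"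
  define R where "R = (\<lambda>(M :: ('a \<times> 'b) set) t. \<forall>j\<in>{1..k}. (s j, t) \<in> M \<longrightarrow> j + d \<le> Suc k)"
  define ext where "ext = (\<lambda>(M, t :: 'b). insert (s (Suc k), t) M)"
  define P where "P = {z\<in>\<Omega> \<times> N. R (fst z) (snd z)}"
  define r where "r = (\<lambda>M. p M - (\<Sum>t\<in>N. q M t))"
  \<comment> \<open>Push-forward of this experiment: \<open>r\<close> is the mass on which nothing
    is inserted, and the sum over the fibre of \<open>ext\<close> collects all insertions producing
    \<open>M'\<close>.\<close>
  define p' where "p' = (\<lambda>M'. (if M' \<in> \<Omega> then r M' else 0) +
    (\<Sum>z | z \<in> P \<and> ext z = M'. q (fst z) (snd z)))"
  have fin': "finite \<Omega>" "finite \<Omega>'" "finite N" "finite P"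
    using fin finite_matchings_upto[OF fin(1)] by (auto simp: \<Omega>_def \<Omega>'_def N_def P_def)
  have sub: "\<Omega> \<subseteq> \<Omega>'" by (fastforce simp: \<Omega>_def \<Omega>'_def matchings_upto_def)
  have ext: "ext ` P \<subseteq> \<Omega>'"
    using matchings_upto_insert[OF inj k] by (auto simp: ext_def P_def R_def N_def \<Omega>_def \<Omega>'_def)
  have q0: "\<And>M t. 0 \<le> q M t" and qR: "\<And>M t. \<not> R M t \<Longrightarrow> q M t = 0"
    and qp: "\<And>M. M \<in> \<Omega> \<Longrightarrow> (\<Sum>t\<in>N. q M t) \<le> p M"
    and qy: "\<And>t. t \<in> N \<Longrightarrow> (\<Sum>M\<in>\<Omega>. q M t) = y (s (Suc k), t)"
    using q unfolding transport_plan_def \<Omega>_def N_def R_def by blast+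
  \<comment> \<open>Change of variables for expectations under \<open>p'\<close>. Constant
    \<open>g\<close> gives the total mass, an indicator gives an edge marginal.\<close>
  have expect: "(\<Sum>M\<in>\<Omega>'. p' M * g M) =
      (\<Sum>M\<in>\<Omega>. r M * g M) + (\<Sum>M\<in>\<Omega>. \<Sum>t\<in>N. q M t * g (insert (s (Suc k), t) M))"
    for g :: "('a \<times> 'b) set \<Rightarrow> real"
  proof -
    have "(\<Sum>M\<in>\<Omega>'. (if M \<in> \<Omega> then r M else 0) * g M) = (\<Sum>M\<in>\<Omega>. r M * g M)"
      using fin' sub by (intro sum.mono_neutral_cong_right) auto
    moreover have "(\<Sum>M\<in>\<Omega>'. (\<Sum>z | z \<in> P \<and> ext z = M. q (fst z) (snd z)) * g M) =
        (\<Sum>M\<in>\<Omega>'. \<Sum>z | z \<in> P \<and> ext z = M. q (fst z) (snd z) * g (ext z))"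
      by (auto simp: sum_distrib_right intro!: sum.cong)
    moreover have "\<dots> = (\<Sum>z\<in>P. q (fst z) (snd z) * g (ext z))"
      using fin' ext by (intro sum.group)
    moreover have "\<dots> = (\<Sum>z\<in>\<Omega> \<times> N. q (fst z) (snd z) * g (ext z))"
      using fin' qR by (intro sum.mono_neutral_left) (auto simp: P_def)
    moreover have "\<dots> = (\<Sum>M\<in>\<Omega>. \<Sum>t\<in>N. q M t * g (insert (s (Suc k), t) M))"
      by (simp add: sum.cartesian_product ext_def case_prod_beta)
    ultimately show ?thesis
      by (simp add: p'_def distrib_right sum.distrib)
  qed
  have "0 \<le> p' M" for M
    using qp[of M] q0 by (auto simp: p'_def r_def intro!: add_nonneg_nonneg sum_nonneg)
  moreover have "sum p' \<Omega>' = 1"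
    using expect[of "\<lambda>_. 1"] p by (simp add: r_def sum_subtractf decomposes_def \<Omega>_def)
  moreover have "(\<Sum>M\<in>\<Omega>'. p' M * of_bool (e \<in> M)) = y e"
    if e: "e \<in> E" "fst e \<in> s ` {1..Suc k}" for e
  proof (cases "fst e = s (Suc k)")
    case True
    then obtain t where t: "e = (s (Suc k), t)" by (metis prod.collapse)
    then have tN: "t \<in> N" using e E by (force simp: N_def)
    \<comment> \<open>No old matching uses the new row, so \<open>e\<close> can only appear by
      inserting \<open>t\<close>, and the marginal is a column sum of \<open>q\<close>.\<close>
    have "e \<notin> M" if "M \<in> \<Omega>" for M
      unfolding t by (rule new_row_notin[OF inj k that[unfolded \<Omega>_def]])
    then have "(\<Sum>M\<in>\<Omega>'. p' M * of_bool (e \<in> M)) = (\<Sum>M\<in>\<Omega>. \<Sum>u\<in>N. q M u * of_bool (t = u))"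
      unfolding expect by (simp add: t)
    also have "\<dots> = (\<Sum>M\<in>\<Omega>. q M t)"
      using fin' tN by simp
    finally show ?thesis using qy tN t by simp
  next
    case False
    have "{1..Suc k} = insert (Suc k) {1..k}" by auto
    then have e': "fst e \<in> s ` {1..k}" using e False by auto
    have ne: "e \<noteq> (s (Suc k), t)" for t using False by auto
    \<comment> \<open>Insertion does not affect whether \<open>e\<close> belongs to the matching, so
      \<open>r M\<close> and the row sum of \<open>q\<close> recombine to
      \<open>p M\<close>.\<close>
    have "(\<Sum>M\<in>\<Omega>'. p' M * of_bool (e \<in> M)) = (\<Sum>M\<in>\<Omega>. p M * of_bool (e \<in> M))"
      unfolding expect
      by (simp add: ne r_def sum.distrib[symmetric] sum_distrib_right[symmetric] left_diff_distrib)
    also have "\<dots> = y e" using p e(1) e' unfolding decomposes_def \<Omega>_def by blast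
    finally show ?thesis .
  qed
  ultimately show ?thesis unfolding decomposes_def \<Omega>'_def by blast
qed

lemma lp1_scaled_decomposes:
  fixes \<alpha> :: real
  assumes inj: "inj_on s {1..n}" and fin: "finite E" "finite T" and E: "snd ` E \<subseteq> T"
    and x: "lp1_feasible s n T E d x"
    and \<alpha>: "1 \<le> \<alpha>" "real (d - 1) * (2 - \<alpha>) \<le> 1" and k: "k \<le> n"
  shows "\<exists>p. decomposes (matchings_upto s n T E d k) p {e\<in>E. fst e \<in> s ` {1..k}} (\<lambda>e. x e / \<alpha>)"
  using k
proof (induction k)
  case 0
  have "matchings_upto s n T E d 0 = {{}}"
    by (auto simp: matchings_upto_def distance_matching_def incident_def)
  then have "decomposes (matchings_upto s n T E d 0) (\<lambda>_. 1) {e\<in>E. fst e \<in> s ` {1..0}} (\<lambda>e. x e / \<alpha>)"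
    by (simp add: decomposes_def)
  then show ?case by blast
next
  case (Suc k)
  then have k: "k < n" by simp
  from Suc obtain p where
    p: "decomposes (matchings_upto s n T E d k) p {e\<in>E. fst e \<in> s ` {1..k}} (\<lambda>e. x e / \<alpha>)"
    by auto
  have "finite {t\<in>T. (s (Suc k), t) \<in> E}" using fin by simp
  from fractional_hall[OF finite_matchings_upto[OF fin(1)] this
      hall_condition_new_row[OF inj fin k x \<alpha> p]]
  obtain q where "transport_plan (\<lambda>M t. \<forall>j\<in>{1..k}. (s j, t) \<in> M \<longrightarrow> j + d \<le> Suc k)
      (matchings_upto s n T E d k) {t\<in>T. (s (Suc k), t) \<in> E} p (\<lambda>t. x (s (Suc k), t) / \<alpha>) q" ..
  from decomposes_Suc[OF inj fin E k p this] show ?case .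
qed

section \<open>The integrality gap\<close>

text \<open>Averaging: the value of \<open>x / \<alpha>\<close> is the expected weight of the random
  matching, hence at most the maximum weight.\<close>

lemma lp1_opt_le_max_weight:
  fixes \<alpha> :: real
  assumes bij: "bij_betw s {1..n} S" and T: "finite T" and E: "E \<subseteq> S \<times> T"
    and \<alpha>: "1 \<le> \<alpha>" "real (d - 1) * (2 - \<alpha>) \<le> 1"
  shows "lp1_opt s n T E d w \<le> \<alpha> * max_weight s n T E d w"
proof -
  have "finite S" using bij_betw_finite[OF bij] by simp
  then have finE: "finite E" using T E finite_subset by blast
  have inj: "inj_on s {1..n}" and S: "s ` {1..n} = S" using bij by (auto simp: bij_betw_def)
  obtain x where x: "lp1_feasible s n T E d x" "lp1_value E w x = lp1_opt s n T E d w"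
    using lp1_opt_attained[OF bij finE E] by blast
  define \<Omega> where "\<Omega> = matchings_upto s n T E d n"
  have "snd ` E \<subseteq> T" "{e\<in>E. fst e \<in> s ` {1..n}} = E" using E S by auto
  then obtain p where p: "decomposes \<Omega> p E (\<lambda>e. x e / \<alpha>)"
    using lp1_scaled_decomposes[OF inj finE T _ x(1) \<alpha>, of n] by (auto simp: \<Omega>_def)
  have sub: "M \<subseteq> E" and w_le: "sum w M \<le> max_weight s n T E d w" if "M \<in> \<Omega>" for M
  proof -
    have M: "distance_matching s n T E d M" using that by (simp add: \<Omega>_def matchings_upto_def)
    then show "M \<subseteq> E" by (simp add: distance_matching_def)
    show "sum w M \<le> max_weight s n T E d w"
      using max_weight_attained[OF finE, of s n T d w] M by metis
  qed
  have "lp1_value E w x / \<alpha> = (\<Sum>e\<in>E. w e * (\<Sum>M\<in>\<Omega>. p M * of_bool (e \<in> M)))"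
    using p by (simp add: lp1_value_def sum_divide_distrib decomposes_def)
  also have "\<dots> = (\<Sum>M\<in>\<Omega>. \<Sum>e\<in>E. p M * (w e * of_bool (e \<in> M)))"
    by (subst sum.swap) (simp add: sum_distrib_left mult_ac)
  also have "\<dots> = (\<Sum>M\<in>\<Omega>. p M * sum w M)"
  proof (rule sum.cong[OF refl])
    fix M assume "M \<in> \<Omega>"
    then have "(\<Sum>e\<in>E. w e * of_bool (e \<in> M)) = sum w M"
      using finE sub by (intro sum.mono_neutral_cong_right) auto
    then show "(\<Sum>e\<in>E. p M * (w e * of_bool (e \<in> M))) = p M * sum w M"
      by (simp add: sum_distrib_left[symmetric])
  qed
  also have "\<dots> \<le> (\<Sum>M\<in>\<Omega>. p M * max_weight s n T E d w)"
    using p w_le by (intro sum_mono mult_left_mono) (auto simp: decomposes_def)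
  also have "\<dots> = max_weight s n T E d w"
    using p by (simp add: decomposes_def sum_distrib_right[symmetric])
  finally show ?thesis using x(2) \<alpha>(1) by (simp add: divide_le_eq mult.commute)
qed

section \<open>Matchings as integral solutions\<close>

lemma lp1_feasible_indicator:
  assumes bij: "bij_betw s {1..n} S" and fin: "finite E" and M: "distance_matching s n T E d M"
  shows "lp1_feasible s n T E d (\<lambda>e. of_bool (e \<in> M))"
proof -
  have sub: "M \<subseteq> E" using M by (simp add: distance_matching_def)
  have "(\<Sum>e\<in>incident E (s i). of_bool (e \<in> M)) \<le> (1::real)" if "i \<in> {1..n}" for i
  proof -
    have "(\<Sum>e\<in>incident E (s i). of_bool (e \<in> M)) = real (card (incident E (s i) \<inter> M))"
      using fin by (subst sum_of_bool_eq) (auto simp: incident_def Int_def)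
    also have "incident E (s i) \<inter> M = incident M (s i)" using sub by (auto simp: incident_def)
    finally show ?thesis using M that by (auto simp: distance_matching_def)
  qed
  moreover have "(\<Sum>v | v \<in> window s n d i \<and> (v, t) \<in> E. of_bool ((v, t) \<in> M)) \<le> (1::real)"
    if i: "i \<in> {1..n}" and t: "t \<in> T" for i t
  proof -
    let ?W = "{v. v \<in> window s n d i \<and> (v, t) \<in> E}"
    have "finite (window s n d i)" by (simp add: window_def)
    then have finW: "finite ?W" by simp
    have "u = v" if "u \<in> ?W \<inter> {v. (v, t) \<in> M}" "v \<in> ?W \<inter> {v. (v, t) \<in> M}" for u v
    proof -
      have "u \<in> s ` {i..min (i + d - 1) n}" "v \<in> s ` {i..min (i + d - 1) n}"
        using that by (simp_all add: window_def)
      then obtain a b where ab: "u = s a" "v = s b" "a \<in> {i..min (i + d - 1) n}" "b \<in> {i..min (i + d - 1) n}"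
        by (elim imageE)
      \<comment> \<open>Two indices in one window are closer than \<open>d\<close>, so a distance
        matching uses \<open>t\<close> at most once there.\<close>
      moreover have "\<bar>int b - int a\<bar> < int d" using ab i by auto
      moreover have "a \<in> {1..n}" "b \<in> {1..n}" using ab i by auto
      ultimately have "a = b"
        using M that t unfolding distance_matching_def by fastforce
      then show ?thesis using ab by simp
    qed
    then have "card (?W \<inter> {v. (v, t) \<in> M}) \<le> Suc 0"
      using finW by (subst card_le_Suc0_iff_eq) blast+
    moreover have "(\<Sum>v\<in>?W. of_bool ((v, t) \<in> M)) = real (card (?W \<inter> {v. (v, t) \<in> M}))"
      using finW by (simp only: sum_of_bool_eq)
    ultimately show ?thesis by simp
  qed
  ultimately show ?thesis unfolding lp1_feasible_def by simp
qed

text \<open>The indicator vector of a best matching is an integral solution. This bounds the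
  denominator of the gap from below.\<close>

lemma max_weight_le_lp1_int_opt:
  assumes bij: "bij_betw s {1..n} S" and T: "finite T" and E: "E \<subseteq> S \<times> T"
  shows "max_weight s n T E d w \<le> lp1_int_opt s n T E d w"
proof -
  have "finite S" using bij_betw_finite[OF bij] by simp
  then have finE: "finite E" using T E finite_subset by blast
  obtain M where M: "distance_matching s n T E d M" "sum w M = max_weight s n T E d w"
    using max_weight_attained[OF finE] by blast
  have "lp1_value E w (\<lambda>e. of_bool (e \<in> M)) = sum w M"
    unfolding lp1_value_def using finE M(1)
    by (intro sum.mono_neutral_cong_right) (auto simp: distance_matching_def)
  moreover have "(of_bool b :: real) \<in> \<int>" for b by (cases b) auto
  ultimately show ?thesis
    using lp1_int_opt_attained[OF bij finE E, of d w] lp1_feasible_indicator[OF bij finE M(1)] M(2)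
    by metis
qed

theorem theorem3:
  fixes s :: "nat \<Rightarrow> 'a" and n :: nat and S :: "'a set" and T :: "'b set"
    and E :: "('a \<times> 'b) set" and w :: "'a \<times> 'b \<Rightarrow> real" and d :: nat
  assumes "bij_betw s {1..n} S"
    and "finite T"
    and "E \<subseteq> S \<times> T"
    and "\<forall>e\<in>E. 0 \<le> w e"
  shows "lp1_opt s n T E d w \<le> (2 - 1 / (2 * real d - 1)) * max_weight s n T E d w \<and>
         lp1_integrality_gap s n T E d w \<le> ereal (2 - 1 / (2 * real d - 1))"
proof -
  let ?\<alpha> = "2 - 1 / (2 * real d - 1)"
  \<comment> \<open>For \<open>d = 0\<close> the real expression \<open>?\<alpha>\<close> equals 3
    and \<open>d - 1\<close> is 0; for \<open>d \<ge> 1\<close> the second claim is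
    \<open>(d - 1) / (2 * d - 1) \<le> 1\<close>.\<close>
  have \<alpha>: "1 \<le> ?\<alpha>" "real (d - 1) * (2 - ?\<alpha>) \<le> 1"
    by (cases d; simp add: field_simps)+
  have opt: "lp1_opt s n T E d w \<le> ?\<alpha> * max_weight s n T E d w"
    by (rule lp1_opt_le_max_weight[OF assms(1-3) \<alpha>])
  also have "\<dots> \<le> ?\<alpha> * lp1_int_opt s n T E d w"
    using max_weight_le_lp1_int_opt[OF assms(1-3)] \<alpha>(1) by (intro mult_left_mono) auto
  finally have gap: "lp1_opt s n T E d w \<le> ?\<alpha> * lp1_int_opt s n T E d w" .
  have "finite S" using bij_betw_finite[OF assms(1)] by simp
  then have finE: "finite E" using assms(2,3) finite_subset by blast
  have nonneg: "0 \<le> lp1_value E w x" if "lp1_feasible s n T E d x" for x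
    using that assms(4) by (auto simp: lp1_value_def lp1_feasible_def intro!: sum_nonneg)
  have "0 \<le> lp1_opt s n T E d w" "0 \<le> lp1_int_opt s n T E d w"
    using lp1_opt_attained[OF assms(1) finE assms(3), of d w]
      lp1_int_opt_attained[OF assms(1) finE assms(3), of d w] nonneg by metis+
  \<comment> \<open>If \<open>b = 0\<close>, the inequality forces \<open>a = 0\<close>, and the
    quotient is \<open>0 / 0 = 0\<close>.\<close>
  moreover have "ereal a / ereal b \<le> ereal c" if "0 \<le> a" "0 \<le> b" "0 \<le> c" "a \<le> c * b" for a b c
    using that by (cases "b = 0") (simp_all add: zero_ereal_def[symmetric] divide_le_eq)
  ultimately have "lp1_integrality_gap s n T E d w \<le> ereal ?\<alpha>"
    using gap \<alpha>(1) unfolding lp1_integrality_gap_def by simp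
  with opt show ?thesis by blast
qed

end
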